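(* Let $q$ be a prime power and let $m,n,d$ be integers with $m \ge n \ge 3$ and $2 \le d<n$. Then $$\delta_q(n\times m, m(n-d+1), d) \le \delta_q(d\times m, m, d) \; \delta_q((n-1)\times m, m(n-d), d)\; \frac {B_q(n \times m, d)}{A_q(n \times m, d)},$$ where $$A_q(n \times m, d) = \binom{mn}{m(n-d+1)}_q, \qquad B_q(n \times m, d) = \binom{md}{m}_q\, \binom{m(n-1)}{m(n-d)}_q.$$
   Context: $\binom{a}{b}_q = \prod_{i=0}^{b-1} \frac{q^a-q^i}{q^b-q^i}$ is the $q$-binomial coefficient. For integers $m\ge s\ge 2$, a (rank-metric) code in $\mathbb{F}_q^{s\times m}$ is a non-zero $\mathbb{F}_q$-linear subspace $\mathcal{C}\le\mathbb{F}_q^{s\times m}$; its minimum distance is $d(\mathcal{C})=\min\{\mathrm{rk}(M) \mid M \in \mathcal{C}, M\ne 0\}$. For $1\le k\le ms$ and $1 \le d \le s$, $$\delta_q(s \times m, k, d):= \frac{|\{\mathcal{C} \le \mathbb{F}_q^{s\times m} \mid \dim(\mathcal{C})=k, \; d(\mathcal{C}) \ge d\}|}{\binom{ms}{k}_q}.$$ *)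

theory Defs
  imports "Jordan_Normal_Form.DL_Rank" "HOL-Number_Theory.Prime_Powers" "HOL-Library.Cardinality"
begin

definition q_binomial :: "nat \<Rightarrow> nat \<Rightarrow> nat \<Rightarrow> real" where
  "q_binomial q a b = (\<Prod>i<b. (real q ^ a - real q ^ i) / (real q ^ b - real q ^ i))"

text \<open>
  The field with \<open>q\<close> elements is a type \<open>'a\<close> of classes \<open>field\<close> and \<open>finite\<close>, with
  \<open>q = CARD('a)\<close>. The space of \<open>s \<times> m\<close> matrices is \<open>module_mat TYPE('a) s m\<close>, a vector
  space over \<open>class_ring\<close>.
\<close>

definition is_code :: "nat \<Rightarrow> nat \<Rightarrow> 'a::field mat set \<Rightarrow> bool" where
  "is_code s m C \<longleftrightarrow>
     VectorSpace.subspace class_ring C (module_mat TYPE('a) s m) \<and> C \<noteq> {0\<^sub>m s m}"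

definition code_dim :: "nat \<Rightarrow> nat \<Rightarrow> 'a::field mat set \<Rightarrow> nat" where
  "code_dim s m C = vectorspace.dim class_ring ((module_mat TYPE('a) s m)\<lparr>carrier := C\<rparr>)"

text \<open>The dimension argument of \<^const>\<open>vec_space.rank\<close> is the number of rows.\<close>

definition min_distance :: "nat \<Rightarrow> nat \<Rightarrow> 'a::field mat set \<Rightarrow> nat" where
  "min_distance s m C = Min {vec_space.rank s M | M. M \<in> C \<and> M \<noteq> 0\<^sub>m s m}"

text \<open>
  Only meaningful for \<open>1 \<le> k \<le> m * s\<close>; then the subspaces of dimension \<open>k\<close> are nonzero, so
  counting codes is the same as counting subspaces.
\<close>

definition code_density ::
    "'a::{field,finite} itself \<Rightarrow> nat \<Rightarrow> nat \<Rightarrow> nat \<Rightarrow> nat \<Rightarrow> real" where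
  "code_density _ s m k d =
     real (card {C :: 'a mat set. is_code s m C \<and> code_dim s m C = k \<and> d \<le> min_distance s m C})
       / q_binomial CARD('a) (m * s) k"

definition A_q :: "nat \<Rightarrow> nat \<Rightarrow> nat \<Rightarrow> nat \<Rightarrow> real" where
  "A_q q n m d = q_binomial q (m * n) (m * (n - d + 1))"

definition B_q :: "nat \<Rightarrow> nat \<Rightarrow> nat \<Rightarrow> nat \<Rightarrow> real" where
  "B_q q n m d = q_binomial q (m * d) m * q_binomial q (m * (n - 1)) (m * (n - d))"

end

theory Submission
  imports Defs
begin

text \<open>
  After multiplying out the \<open>q\<close>-binomial coefficients, the claim is about numbers of codes: there
  are at most as many codes in the \<open>n \<times> m\<close> matrices of dimension \<open>m (n - d + 1)\<close> and minimum
  distance at least \<open>d\<close> as there are pairs of such codes with \<open>n\<close> replaced by \<open>d\<close> and by \<open>n - 1\<close>.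
  All these codes attain the Singleton bound \<open>dim C \<le> m (s - d + 1)\<close> for \<open>s \<times> m\<close> matrices.

  A code \<open>C\<close> is sent to the pair of its subcodes \<open>C\<^sub>2\<close>, supported in the last \<open>d\<close> rows, and \<open>C\<^sub>1\<close>,
  supported in the first \<open>n - 1\<close> rows. Demanding that \<open>n - r\<close> rows vanish costs at most
  \<open>m (n - r)\<close> dimensions (\<open>card_le_card_shorten\<close>), and together with the Singleton bound this
  forces \<open>dim C\<^sub>2 = m\<close> and \<open>dim C\<^sub>1 = m (n - d)\<close> (\<open>card_shorten_maximal\<close>). A matrix in both
  subcodes has only \<open>d - 1\<close> rows that may be nonzero, hence rank less than \<open>d\<close>, hence is zero. As
  the two dimensions add up to \<open>dim C\<close>, the code is \<open>C\<^sub>1 \<oplus> C\<^sub>2\<close> (\<open>maximal_code_eq_sum_shortened\<close>)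
  and so is determined by the pair.

  Dimensions are handled through cardinalities: over a field with \<open>q\<close> elements a space of
  dimension \<open>k\<close> has \<open>q ^ k\<close> elements, which turns rank-nullity arguments into counts of fibres.
\<close>

section \<open>Counting in vector spaces over a finite field\<close>

lemma (in vectorspace) card_carrier_eq_power_dim:
  assumes fin: "finite (carrier V)"
  shows "card (carrier V) = card (carrier K) ^ dim"
proof -
  have "gen_set (carrier V)"
    using in_own_span[of "carrier V"] span_is_subset2[of "carrier V"] by blast
  then have "fin_dim"
    unfolding fin_dim_def using fin by blast
  then obtain B where B: "finite B" "basis B"
    using finite_basis_exists by blast
  have BV: "B \<subseteq> carrier V"
    using B(2) by (simp add: basis_def)
  have uni: "\<exists>!a. a \<in> B \<rightarrow>\<^sub>E carrier K \<and> lincomb a B = v" if "v \<in> carrier V" for v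
    using basis_criterion[OF B(1) BV] B(2) that by blast
  have cl: "lincomb a B \<in> carrier V" if "a \<in> B \<rightarrow>\<^sub>E carrier K" for a
    using that BV by (intro lincomb_closed) auto
  have "bij_betw (\<lambda>a. lincomb a B) (B \<rightarrow>\<^sub>E carrier K) (carrier V)"
  proof (rule bij_betw_imageI)
    show "inj_on (\<lambda>a. lincomb a B) (B \<rightarrow>\<^sub>E carrier K)"
    proof (rule inj_onI)
      fix a b assume "a \<in> B \<rightarrow>\<^sub>E carrier K" "b \<in> B \<rightarrow>\<^sub>E carrier K" "lincomb a B = lincomb b B"
      with uni[OF cl] show "a = b" by blast
    qed
    show "(\<lambda>a. lincomb a B) ` (B \<rightarrow>\<^sub>E carrier K) = carrier V"
    proof
      show "carrier V \<subseteq> (\<lambda>a. lincomb a B) ` (B \<rightarrow>\<^sub>E carrier K)"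
      proof
        fix v assume "v \<in> carrier V"
        from uni[OF this] show "v \<in> (\<lambda>a. lincomb a B) ` (B \<rightarrow>\<^sub>E carrier K)" by blast
      qed
    qed (use cl in blast)
  qed
  then have "card (carrier V) = card (B \<rightarrow>\<^sub>E carrier K)"
    by (simp add: bij_betw_same_card)
  also have "\<dots> = card (carrier K) ^ card B"
    using B(1) by (rule card_funcsetE)
  finally show ?thesis
    using dim_basis[OF B] by simp
qed

lemma finite_carrier_mat: "finite (carrier_mat n m :: 'a::finite mat set)"
proof (rule finite_subset)
  show "(carrier_mat n m :: 'a mat set) \<subseteq> mat n m ` (({..<n} \<times> {..<m}) \<rightarrow>\<^sub>E UNIV)"
  proof
    fix M :: "'a mat" assume M: "M \<in> carrier_mat n m"
    then have eq: "M = mat n m (restrict (\<lambda>p. M $$ p) ({..<n} \<times> {..<m}))"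
      by (intro eq_matI) auto
    show "M \<in> mat n m ` (({..<n} \<times> {..<m}) \<rightarrow>\<^sub>E UNIV)"
      by (rule image_eqI[where f = "mat n m", OF eq]) auto
  qed
qed (intro finite_imageI finite_PiE, auto)

lemma finite_carrier_vec: "finite (carrier_vec n :: 'a::finite vec set)"
proof (rule finite_subset)
  show "(carrier_vec n :: 'a vec set) \<subseteq> vec n ` ({..<n} \<rightarrow>\<^sub>E UNIV)"
  proof
    fix v :: "'a vec" assume v: "v \<in> carrier_vec n"
    then have eq: "v = vec n (restrict (\<lambda>i. v $ i) {..<n})"
      by (intro eq_vecI) auto
    show "v \<in> vec n ` ({..<n} \<rightarrow>\<^sub>E UNIV)"
      by (rule image_eqI[where f = "vec n", OF eq]) auto
  qed
qed (intro finite_imageI finite_PiE, auto)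

lemma card_subspace_mat:
  assumes "VectorSpace.subspace class_ring C (module_mat TYPE('a::{field,finite}) s m)"
  shows "card C = CARD('a) ^ code_dim s m C"
proof -
  interpret V: matrix_vs s m "TYPE('a)" .
  have "vectorspace class_ring ((module_mat TYPE('a) s m)\<lparr>carrier := C\<rparr>)"
    using V.subspace_is_vs[OF assms] .
  moreover have "C \<subseteq> carrier_mat s m"
    using V.is_module[OF assms] by (auto simp: submodule_def module_mat_simps)
  then have "finite C"
    using finite_carrier_mat finite_subset by blast
  ultimately show ?thesis
    using vectorspace.card_carrier_eq_power_dim[of class_ring "(module_mat TYPE('a) s m)\<lparr>carrier := C\<rparr>"]
    by (simp add: code_dim_def)
qed

text \<open>The rank is the dimension of the column space, which is the image of the matrix.\<close>

lemma power_rank_eq_card_image: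
  fixes A :: "'a::{field,finite} mat"
  assumes A: "A \<in> carrier_mat s m"
  shows "CARD('a) ^ vec_space.rank s A = card ((\<lambda>x. A *\<^sub>v x) ` carrier_vec m)"
proof -
  interpret V: vec_space "TYPE('a)" s .
  have cols: "set (cols A) \<subseteq> carrier_vec s"
    using A cols_dim by blast
  have im: "V.span (set (cols A)) = (\<lambda>x. A *\<^sub>v x) ` carrier_vec m"
    using V.col_space_eq[OF A] A unfolding V.col_space_def by auto
  have vs: "vectorspace class_ring (V.span_vs (set (cols A)))"
    using V.subspace_is_vs[OF V.span_is_subspace[OF cols]] .
  have "finite ((\<lambda>x. A *\<^sub>v x) ` carrier_vec m)"
    by (intro finite_imageI finite_carrier_vec)
  then show ?thesis
    using vectorspace.card_carrier_eq_power_dim[OF vs] im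
    by (simp add: V.rank_def)
qed

lemma rank_le_dim_row:
  fixes A :: "'a::field mat"
  assumes A: "A \<in> carrier_mat s m"
  shows "vec_space.rank s A \<le> s"
proof -
  interpret V: vec_space "TYPE('a)" s .
  have cols: "set (cols A) \<subseteq> carrier_vec s"
    using A cols_dim by blast
  show ?thesis
    using V.subspace_dim[OF V.span_is_subspace[OF cols] V.fin_dim V.fin_dim_span_cols[OF A]]
    by (simp add: V.rank_def V.dim_is_n)
qed

lemma one_less_card_field: "1 < CARD('a::{field,finite})"
proof -
  have "card {0, 1 :: 'a} \<le> CARD('a)"
    by (intro card_mono) auto
  then show ?thesis by simp
qed

lemma q_binomial_pos:
  assumes "2 \<le> q" "b \<le> a"
  shows "0 < q_binomial q a b"
  unfolding q_binomial_def
proof (rule prod_pos, intro ballI divide_pos_pos)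
  fix i assume "i \<in> {..<b}"
  with assms show "0 < real q ^ a - real q ^ i" "0 < real q ^ b - real q ^ i"
    by (auto intro!: power_strict_increasing)
qed

section \<open>Rank-metric codes and shortening\<close>

text \<open>
  A linear space of \<open>s \<times> m\<close> matrices whose nonzero members all have rank at least \<open>d\<close>. The zero
  space is included: it satisfies every bound.
\<close>

definition rank_code :: "nat \<Rightarrow> nat \<Rightarrow> nat \<Rightarrow> 'a::field mat set \<Rightarrow> bool" where
  "rank_code s m d C \<longleftrightarrow>
     VectorSpace.subspace class_ring C (module_mat TYPE('a) s m) \<and>
     (\<forall>M\<in>C. M \<noteq> 0\<^sub>m s m \<longrightarrow> d \<le> vec_space.rank s M)"

lemma subspace_mat_iff:
  "VectorSpace.subspace class_ring C (module_mat TYPE('a::field) s m) \<longleftrightarrow>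
     C \<subseteq> carrier_mat s m \<and> 0\<^sub>m s m \<in> C \<and>
     (\<forall>M\<in>C. \<forall>N\<in>C. M + N \<in> C) \<and> (\<forall>c. \<forall>M\<in>C. c \<cdot>\<^sub>m M \<in> C)"
  using matrix_vs[where 'a = 'a, of s m]
  by (auto simp: VectorSpace.subspace_def submodule_def vectorspace_def module_mat_simps)

lemma rank_codeD:
  fixes C :: "'a::field mat set"
  assumes "rank_code s m d C"
  shows "C \<subseteq> carrier_mat s m" "0\<^sub>m s m \<in> C"
    and "M \<in> C \<Longrightarrow> N \<in> C \<Longrightarrow> M + N \<in> C"
    and "M \<in> C \<Longrightarrow> c \<cdot>\<^sub>m M \<in> C"
    and "M \<in> C \<Longrightarrow> M \<noteq> 0\<^sub>m s m \<Longrightarrow> d \<le> vec_space.rank s M"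
  using assms unfolding rank_code_def subspace_mat_iff by blast+

lemma rank_code_minus:
  assumes C: "rank_code s m d C" and "M \<in> C" "N \<in> C"
  shows "M - N \<in> C"
proof -
  have "M - N = M + (-1) \<cdot>\<^sub>m N"
    using assms rank_codeD(1)[OF C] by (intro eq_matI) auto
  then show ?thesis
    using assms rank_codeD(3,4)[OF C] by simp
qed

lemma code_iff_rank_code:
  fixes C :: "'a::{field,finite} mat set"
  assumes "1 \<le> k"
  shows "is_code s m C \<and> code_dim s m C = k \<and> d \<le> min_distance s m C \<longleftrightarrow>
    rank_code s m d C \<and> card C = CARD('a) ^ k"
proof (cases "VectorSpace.subspace class_ring C (module_mat TYPE('a) s m)")
  case True
  have q: "1 < CARD('a)"
    using one_less_card_field by simp
  have card: "card C = CARD('a) ^ code_dim s m C"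
    using True by (rule card_subspace_mat)
  have fin: "finite C"
    using True finite_carrier_mat finite_subset unfolding subspace_mat_iff by blast
  have zero: "0\<^sub>m s m \<in> C"
    using True by (simp add: subspace_mat_iff)
  have dim: "code_dim s m C = k \<longleftrightarrow> card C = CARD('a) ^ k"
    using card q by (auto simp: power_inject_exp)
  show ?thesis
  proof (cases "card C = CARD('a) ^ k")
    case k: True
    \<comment> \<open>Since \<open>k \<ge> 1\<close>, the space is nonzero and the minimum ranges over a nonempty set.\<close>
    have "1 < card C"
      unfolding k using q assms by (intro one_less_power) auto
    then have ne: "C \<noteq> {0\<^sub>m s m}"
      by auto
    let ?R = "{vec_space.rank s M | M. M \<in> C \<and> M \<noteq> 0\<^sub>m s m}"
    have "finite ?R" "?R \<noteq> {}"
      using fin ne zero by auto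
    then have "d \<le> min_distance s m C \<longleftrightarrow> (\<forall>M\<in>C. M \<noteq> 0\<^sub>m s m \<longrightarrow> d \<le> vec_space.rank s M)"
      unfolding min_distance_def by (subst Min_ge_iff) auto
    then show ?thesis
      using True ne dim k by (simp add: is_code_def rank_code_def)
  qed (use dim in auto)
qed (auto simp: is_code_def rank_code_def)

text \<open>Insert the rows of \<open>N\<close> as rows \<open>l, l + 1, \<dots>\<close> of a matrix with \<open>n\<close> rows, the other rows being zero.\<close>

definition pad_rows :: "nat \<Rightarrow> nat \<Rightarrow> 'a::zero mat \<Rightarrow> 'a mat" where
  "pad_rows n l N = mat n (dim_col N)
     (\<lambda>(i, j). if l \<le> i \<and> i < l + dim_row N then N $$ (i - l, j) else 0)"

text \<open>The members of \<open>C\<close> supported in the rows \<open>l, \<dots>, l + r - 1\<close>, with all the other rows deleted.\<close>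

definition shorten :: "nat \<Rightarrow> nat \<Rightarrow> nat \<Rightarrow> nat \<Rightarrow> 'a::zero mat set \<Rightarrow> 'a mat set" where
  "shorten n m l r C = {N \<in> carrier_mat r m. pad_rows n l N \<in> C}"

lemma pad_rows_dim [simp]:
  "dim_row (pad_rows n l N) = n" "dim_col (pad_rows n l N) = dim_col N"
  by (simp_all add: pad_rows_def)

lemma pad_rows_carrier [simp]: "N \<in> carrier_mat r m \<Longrightarrow> pad_rows n l N \<in> carrier_mat n m"
  by (auto simp: pad_rows_def)

lemma pad_rows_index:
  assumes "N \<in> carrier_mat r m" "i < n" "j < m"
  shows "pad_rows n l N $$ (i, j) = (if l \<le> i \<and> i < l + r then N $$ (i - l, j) else 0)"
  using assms by (auto simp: pad_rows_def)

lemma pad_rows_zero: "pad_rows n l (0\<^sub>m r m) = 0\<^sub>m n m"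
  by (intro eq_matI) (auto simp: pad_rows_def)

lemma pad_rows_add:
  fixes M N :: "'a::monoid_add mat"
  assumes "M \<in> carrier_mat r m" "N \<in> carrier_mat r m"
  shows "pad_rows n l (M + N) = pad_rows n l M + pad_rows n l N"
  using assms by (intro eq_matI) (auto simp: pad_rows_def)

lemma pad_rows_minus:
  fixes M N :: "'a::ab_group_add mat"
  assumes "M \<in> carrier_mat r m" "N \<in> carrier_mat r m"
  shows "pad_rows n l (M - N) = pad_rows n l M - pad_rows n l N"
  using assms by (intro eq_matI) (auto simp: pad_rows_def)

lemma pad_rows_smult:
  fixes N :: "'a::semiring_0 mat"
  shows "pad_rows n l (c \<cdot>\<^sub>m N) = c \<cdot>\<^sub>m pad_rows n l N"
  by (intro eq_matI) (auto simp: pad_rows_def)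

lemma pad_rows_inj:
  assumes "l + r \<le> n" "M \<in> carrier_mat r m" "N \<in> carrier_mat r m"
    and eq: "pad_rows n l M = pad_rows n l N"
  shows "M = N"
proof (rule eq_matI)
  fix i j assume "i < dim_row N" "j < dim_col N"
  with assms(1-3) have "l + i < n" "j < m" "i < r" by auto
  then show "M $$ (i, j) = N $$ (i, j)"
    using arg_cong[OF eq, of "\<lambda>A. A $$ (l + i, j)"] assms(2,3) by (simp add: pad_rows_index)
qed (use assms in auto)

lemma pad_rows_surj:
  assumes M: "M \<in> carrier_mat n m" and lr: "l + r \<le> n"
    and supp: "\<And>i j. i < n \<Longrightarrow> j < m \<Longrightarrow> \<not> (l \<le> i \<and> i < l + r) \<Longrightarrow> M $$ (i, j) = 0"
  obtains N where "N \<in> carrier_mat r m" "M = pad_rows n l N"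
proof
  let ?N = "mat r m (\<lambda>(i, j). M $$ (l + i, j))"
  show "?N \<in> carrier_mat r m" by simp
  show "M = pad_rows n l ?N"
    using M supp by (intro eq_matI) (auto simp: pad_rows_def)
qed

lemma rank_pad_rows:
  fixes N :: "'a::{field,finite} mat"
  assumes N: "N \<in> carrier_mat r m" and lr: "l + r \<le> n"
  shows "vec_space.rank n (pad_rows n l N) = vec_space.rank r N"
proof -
  let ?P = "pad_rows n l N"
  have P: "?P \<in> carrier_mat n m" using N by simp
  have row: "row ?P (l + i) = row N i" if "i < r" for i
    using that N lr by (intro eq_vecI) (auto simp: pad_rows_def)
  have row0: "row ?P i = 0\<^sub>v m" if "i < n" "\<not> (l \<le> i \<and> i < l + r)" for i
    using that N by (intro eq_vecI) (auto simp: pad_rows_def)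
  \<comment> \<open>The entries of \<open>?P *\<^sub>v x\<close> are those of \<open>N *\<^sub>v x\<close> and zeros, so deleting rows is a bijection
    between the two column spaces.\<close>
  let ?f = "\<lambda>v. vec r (\<lambda>i. v $ (l + i))"
  have f: "?f (?P *\<^sub>v x) = N *\<^sub>v x" for x
  proof (rule eq_vecI)
    fix i assume "i < dim_vec (N *\<^sub>v x)"
    then have "i < r" "l + i < n" using N lr by auto
    then show "?f (?P *\<^sub>v x) $ i = (N *\<^sub>v x) $ i"
      using row[of i] N P by simp
  qed (use N in simp)
  have inj: "inj_on ?f ((\<lambda>x. ?P *\<^sub>v x) ` carrier_vec m)"
  proof (rule inj_onI, clarify)
    fix x y :: "'a vec" assume x: "x \<in> carrier_vec m" and y: "y \<in> carrier_vec m"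
      and "?f (?P *\<^sub>v x) = ?f (?P *\<^sub>v y)"
    then have eq: "N *\<^sub>v x = N *\<^sub>v y" by (simp only: f)
    show "?P *\<^sub>v x = ?P *\<^sub>v y"
    proof (rule eq_vecI)
      fix i assume "i < dim_vec (?P *\<^sub>v y)"
      then have i: "i < n" using P by simp
      show "(?P *\<^sub>v x) $ i = (?P *\<^sub>v y) $ i"
      proof (cases "l \<le> i \<and> i < l + r")
        case True
        then have "row ?P i = row N (i - l)" "i - l < r"
          using row[of "i - l"] by auto
        then show ?thesis
          using arg_cong[OF eq, of "\<lambda>v. v $ (i - l)"] i N P by simp
      next
        case False
        then show ?thesis using row0[OF i] i P x y by simp
      qed
    qed (use P in simp)
  qed
  have "(\<lambda>x. N *\<^sub>v x) ` carrier_vec m = ?f ` ((\<lambda>x. ?P *\<^sub>v x) ` carrier_vec m)"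
    by (simp add: image_image f)
  then have "CARD('a) ^ vec_space.rank r N = CARD('a) ^ vec_space.rank n ?P"
    unfolding power_rank_eq_card_image[OF N] power_rank_eq_card_image[OF P]
    using card_image[OF inj] by simp
  moreover have "1 < CARD('a)"
    using one_less_card_field by simp
  ultimately show ?thesis by (simp add: power_inject_exp)
qed

lemma rank_code_shorten:
  fixes C :: "'a::{field,finite} mat set"
  assumes C: "rank_code n m d C" and lr: "l + r \<le> n"
  shows "rank_code r m d (shorten n m l r C)"
  unfolding rank_code_def subspace_mat_iff
proof (intro conjI ballI allI impI)
  fix N assume N: "N \<in> shorten n m l r C" "N \<noteq> 0\<^sub>m r m"
  then have "pad_rows n l N \<noteq> 0\<^sub>m n m"
    using pad_rows_inj[OF lr, of N m "0\<^sub>m r m"] by (auto simp: shorten_def pad_rows_zero)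
  then show "d \<le> vec_space.rank r N"
    using N rank_codeD(5)[OF C, of "pad_rows n l N"] rank_pad_rows[of N r m l n] lr
    by (simp add: shorten_def)
qed (use rank_codeD[OF C] in \<open>auto simp: shorten_def pad_rows_zero pad_rows_add pad_rows_smult\<close>)

text \<open>Fewer than \<open>d\<close> rows leave no room for rank \<open>d\<close>.\<close>

lemma shorten_eq_zero:
  fixes C :: "'a::{field,finite} mat set"
  assumes C: "rank_code n m d C" and lr: "l + r \<le> n" and "r < d"
  shows "shorten n m l r C = {0\<^sub>m r m}"
proof -
  note S = rank_codeD[OF rank_code_shorten[OF C lr]]
  have "N = 0\<^sub>m r m" if N: "N \<in> shorten n m l r C" for N
    using S(1) S(5)[OF N] rank_le_dim_row[of N r m] N \<open>r < d\<close> by fastforce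
  then show ?thesis using S(2) by blast
qed

text \<open>
  The number of members of \<open>C\<close> is at most the number of those that vanish outside a window of \<open>r\<close>
  rows, times the number of ways to fill the other \<open>n - r\<close> rows: two members with the same entries
  outside the window differ by one that vanishes there.
\<close>

lemma card_le_card_shorten:
  fixes C :: "'a::{field,finite} mat set"
  assumes C: "rank_code n m d C" and lr: "l + r \<le> n"
  shows "card C \<le> card (shorten n m l r C) * CARD('a) ^ (m * (n - r))"
proof -
  let ?D = "({..<n} - {l..<l + r}) \<times> {..<m}"
  define f :: "'a mat \<Rightarrow> nat \<times> nat \<Rightarrow> 'a" where "f = (\<lambda>M. restrict (\<lambda>p. M $$ p) ?D)"
  have fin: "finite C" "finite (shorten n m l r C)"
    using rank_codeD(1)[OF C] rank_codeD(1)[OF rank_code_shorten[OF C lr]]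
      finite_carrier_mat finite_subset by blast+
  have fibre: "card {M \<in> C. f M = y} \<le> card (shorten n m l r C)" for y
  proof (cases "\<exists>M0\<in>C. f M0 = y")
    case True
    then obtain M0 where M0: "M0 \<in> C" "f M0 = y" by blast
    have "(\<lambda>M. M - M0) ` {M \<in> C. f M = y} \<subseteq> pad_rows n l ` shorten n m l r C"
    proof clarify
      fix M assume M: "M \<in> C" "y = f M"
      have MM: "M \<in> carrier_mat n m" "M0 \<in> carrier_mat n m"
        using M(1) M0(1) rank_codeD(1)[OF C] by auto
      have diff: "(M - M0) $$ (i, j) = 0" if "i < n" "j < m" "\<not> (l \<le> i \<and> i < l + r)" for i j
      proof -
        have "f M (i, j) = f M0 (i, j)"
          using M(2) M0(2) by simp
        moreover have "(i, j) \<in> ?D"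
          using that by auto
        ultimately show ?thesis
          using MM that by (simp only: f_def restrict_apply' index_minus_mat) simp
      qed
      then obtain N where N: "N \<in> carrier_mat r m" "M - M0 = pad_rows n l N"
        using pad_rows_surj[OF minus_carrier_mat[OF MM(2)] lr diff] by blast
      then have "N \<in> shorten n m l r C"
        using rank_code_minus[OF C M(1) M0(1)] by (simp add: shorten_def)
      then show "M - M0 \<in> pad_rows n l ` shorten n m l r C"
        using N(2) by blast
    qed
    moreover have "inj_on (\<lambda>M. M - M0) {M \<in> C. f M = y}"
    proof (rule inj_onI)
      fix M N assume M: "M \<in> {M \<in> C. f M = y}" and N: "N \<in> {M \<in> C. f M = y}"
        and eq: "M - M0 = N - M0"
      have MM: "M \<in> carrier_mat n m" "N \<in> carrier_mat n m" "M0 \<in> carrier_mat n m"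
        using M N M0(1) rank_codeD(1)[OF C] by auto
      have "M = M - M0 + M0" "N = N - M0 + M0"
        using MM by (intro eq_matI; auto)+
      then show "M = N" using eq by simp
    qed
    ultimately have "card {M \<in> C. f M = y} \<le> card (pad_rows n l ` shorten n m l r C)"
      using fin by (intro card_inj_on_le) auto
    also have "\<dots> \<le> card (shorten n m l r C)"
      using fin(2) by (rule card_image_le)
    finally show ?thesis .
  next
    case False
    then have "{M \<in> C. f M = y} = {}" by blast
    then show ?thesis by (simp only: card.empty le0)
  qed
  have finD: "finite (?D \<rightarrow>\<^sub>E (UNIV :: 'a set))"
    by (intro finite_PiE) auto
  have "C = (\<Union>y\<in>?D \<rightarrow>\<^sub>E UNIV. {M \<in> C. f M = y})"
    by (auto simp: f_def)
  then have "card C \<le> (\<Sum>y\<in>?D \<rightarrow>\<^sub>E (UNIV :: 'a set). card {M \<in> C. f M = y})"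
    using card_UN_le[OF finD, of "\<lambda>y. {M \<in> C. f M = y}"] by simp
  also have "\<dots> \<le> (\<Sum>y\<in>?D \<rightarrow>\<^sub>E (UNIV :: 'a set). card (shorten n m l r C))"
    by (intro sum_mono fibre)
  also have "\<dots> = card (?D \<rightarrow>\<^sub>E (UNIV :: 'a set)) * card (shorten n m l r C)"
    by simp
  also have "card (?D \<rightarrow>\<^sub>E (UNIV :: 'a set)) = CARD('a) ^ (m * (n - r))"
  proof -
    have "card ({..<n} - {l..<l + r}) = n - r"
      using lr by (subst card_Diff_subset) auto
    then show ?thesis
      by (simp add: card_funcsetE card_cartesian_product mult.commute)
  qed
  finally show ?thesis by (simp add: mult.commute)
qed

section \<open>Codes of maximal dimension\<close>

text \<open>
  The Singleton bound, in terms of cardinalities: no nonzero member is supported in the first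
  \<open>d - 1\<close> rows.
\<close>

lemma singleton_bound:
  fixes C :: "'a::{field,finite} mat set"
  assumes C: "rank_code n m d C" and "1 \<le> d" "d \<le> n"
  shows "card C \<le> CARD('a) ^ (m * (n - d + 1))"
proof -
  have "shorten n m 0 (d - 1) C = {0\<^sub>m (d - 1) m}"
    using assms by (intro shorten_eq_zero[OF C]) auto
  moreover have "n - (d - 1) = n - d + 1"
    using assms by simp
  ultimately show ?thesis
    using card_le_card_shorten[OF C, of 0 "d - 1"] assms by simp
qed

text \<open>Shortening a code that attains the Singleton bound gives another such code.\<close>

lemma card_shorten_maximal:
  fixes C :: "'a::{field,finite} mat set"
  assumes C: "rank_code n m d C" and card: "card C = CARD('a) ^ (m * (n - d + 1))"
    and "1 \<le> d" "d \<le> r" and lr: "l + r \<le> n"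
  shows "card (shorten n m l r C) = CARD('a) ^ (m * (r - d + 1))"
proof (rule antisym)
  show "card (shorten n m l r C) \<le> CARD('a) ^ (m * (r - d + 1))"
    using assms by (intro singleton_bound rank_code_shorten[OF C lr]) auto
  have "n - d + 1 = (r - d + 1) + (n - r)"
    using assms by simp
  then have "CARD('a) ^ (m * (r - d + 1)) * CARD('a) ^ (m * (n - r)) = card C"
    unfolding card power_add[symmetric] distrib_left[symmetric] by simp
  also have "\<dots> \<le> card (shorten n m l r C) * CARD('a) ^ (m * (n - r))"
    by (rule card_le_card_shorten[OF C lr])
  finally show "CARD('a) ^ (m * (r - d + 1)) \<le> card (shorten n m l r C)"
    by simp
qed

text \<open>
  A code attaining the Singleton bound is the sum of its members supported in the first
  \<open>n - 1\<close> rows and those supported in the last \<open>d\<close> rows.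
\<close>

lemma maximal_code_eq_sum_shortened:
  fixes C :: "'a::{field,finite} mat set"
  assumes C: "rank_code n m d C" and card: "card C = CARD('a) ^ (m * (n - d + 1))"
    and d: "1 \<le> d" "d < n"
  shows "C = (\<lambda>(M, N). pad_rows n 0 M + pad_rows n (n - d) N) `
    (shorten n m 0 (n - 1) C \<times> shorten n m (n - d) d C)"
    (is "C = ?s ` (?A \<times> ?B)")
proof (rule sym, rule card_subset_eq)
  show "finite C"
    using rank_codeD(1)[OF C] finite_carrier_mat finite_subset by blast
  show "?s ` (?A \<times> ?B) \<subseteq> C"
    using rank_codeD(3)[OF C] by (auto simp: shorten_def)
  have "inj_on ?s (?A \<times> ?B)"
  proof (rule inj_onI, clarify)
    fix M N M' N'
    assume M: "M \<in> ?A" "M' \<in> ?A" and N: "N \<in> ?B" "N' \<in> ?B"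
      and eq: "pad_rows n 0 M + pad_rows n (n - d) N = pad_rows n 0 M' + pad_rows n (n - d) N'"
    have c: "M \<in> carrier_mat (n - 1) m" "M' \<in> carrier_mat (n - 1) m"
        "N \<in> carrier_mat d m" "N' \<in> carrier_mat d m"
      using M N by (auto simp: shorten_def)
    define X where "X = pad_rows n 0 (M - M')"
    have X: "X = pad_rows n 0 M - pad_rows n 0 M'"
      unfolding X_def by (rule pad_rows_minus[OF c(1,2)])
    have Xc: "X \<in> carrier_mat n m"
      unfolding X_def by (rule pad_rows_carrier[OF minus_carrier_mat[OF c(2)]])
    have entry: "X $$ (i, j) = pad_rows n (n - d) N' $$ (i, j) - pad_rows n (n - d) N $$ (i, j)"
      if "i < n" "j < m" for i j
    proof -
      from arg_cong[OF eq, of "\<lambda>Y. Y $$ (i, j)"]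
      have sums: "pad_rows n 0 M $$ (i, j) + pad_rows n (n - d) N $$ (i, j)
          = pad_rows n 0 M' $$ (i, j) + pad_rows n (n - d) N' $$ (i, j)"
        using that c[THEN carrier_matD(2)] by simp
      have "X $$ (i, j) = pad_rows n 0 M $$ (i, j) - pad_rows n 0 M' $$ (i, j)"
        unfolding X using that c[THEN carrier_matD(2)] by simp
      also have "\<dots> = (pad_rows n 0 M $$ (i, j) + pad_rows n (n - d) N $$ (i, j))
          - (pad_rows n 0 M' $$ (i, j) + pad_rows n (n - d) N $$ (i, j))"
        by simp
      also have "\<dots> = pad_rows n (n - d) N' $$ (i, j) - pad_rows n (n - d) N $$ (i, j)"
        unfolding sums by simp
      finally show ?thesis .
    qed
    \<comment> \<open>The difference lives in the overlap of the two windows, which has only \<open>d - 1\<close> rows.\<close>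
    have "X $$ (i, j) = 0" if "i < n" "j < m" "\<not> (n - d \<le> i \<and> i < n - d + (d - 1))" for i j
    proof (cases "n - d \<le> i")
      case True
      then have "\<not> i < n - 1" using that d by simp
      then show ?thesis
        using that pad_rows_index[OF minus_carrier_mat[OF c(2)], of i n j 0 M] by (simp add: X_def)
    next
      case False
      then show ?thesis
        using c that by (simp add: entry pad_rows_index)
    qed
    then obtain Y where Y: "Y \<in> carrier_mat (d - 1) m" "X = pad_rows n (n - d) Y"
      using pad_rows_surj[OF Xc, of "n - d" "d - 1"] d by auto
    have "X \<in> C"
      unfolding X using M by (intro rank_code_minus[OF C]) (auto simp: shorten_def)
    then have "Y \<in> shorten n m (n - d) (d - 1) C"
      using Y by (simp add: shorten_def)
    then have "Y = 0\<^sub>m (d - 1) m"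
      using shorten_eq_zero[OF C, of "n - d" "d - 1"] d by simp
    then have X0: "X = 0\<^sub>m n m"
      using Y(2) by (simp add: pad_rows_zero)
    have "pad_rows n 0 M = pad_rows n 0 M'"
    proof (rule eq_matI)
      fix i j assume "i < dim_row (pad_rows n 0 M')" "j < dim_col (pad_rows n 0 M')"
      then show "pad_rows n 0 M $$ (i, j) = pad_rows n 0 M' $$ (i, j)"
        using arg_cong[OF X0, of "\<lambda>Y. Y $$ (i, j)"] c[THEN carrier_matD(2)] by (simp add: X)
    qed (use c in auto)
    moreover have "pad_rows n (n - d) N = pad_rows n (n - d) N'"
      using entry X0 c by (intro eq_matI) (auto simp: pad_rows_def)
    ultimately show "M = M' \<and> N = N'"
      using pad_rows_inj[of 0 "n - 1" n M m M'] pad_rows_inj[of "n - d" d n N m N'] c d by simp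
  qed
  then have "card (?s ` (?A \<times> ?B)) = card ?A * card ?B"
    by (simp add: card_image card_cartesian_product)
  also have "\<dots> = CARD('a) ^ (m * (n - 1 - d + 1)) * CARD('a) ^ (m * (d - d + 1))"
    using card_shorten_maximal[OF C card d(1), of "n - 1" 0]
      card_shorten_maximal[OF C card d(1), of d "n - d"] d by simp
  also have "\<dots> = CARD('a) ^ (m * (n - d + 1))"
  proof -
    have "n - d + 1 = (n - 1 - d + 1) + (d - d + 1)"
      using d by simp
    then show ?thesis
      unfolding power_add[symmetric] distrib_left[symmetric] by simp
  qed
  finally show "card (?s ` (?A \<times> ?B)) = card C"
    using card by simp
qed

text \<open>By the previous lemma, a maximal code can be recovered from its two shortened codes.\<close>

lemma card_maximal_codes_le:
  assumes d: "1 \<le> d" "d < n"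
  shows "card {C :: 'a::{field,finite} mat set.
        rank_code n m d C \<and> card C = CARD('a) ^ (m * (n - d + 1))}
    \<le> card {C :: 'a mat set. rank_code d m d C \<and> card C = CARD('a) ^ m}
      * card {C :: 'a mat set. rank_code (n - 1) m d C \<and> card C = CARD('a) ^ (m * (n - d))}"
    (is "card ?X \<le> card ?Y * card ?Z")
proof -
  have fin: "finite {C :: 'a mat set. rank_code s m d C \<and> P C}" for s P
  proof (rule finite_subset)
    show "{C :: 'a mat set. rank_code s m d C \<and> P C} \<subseteq> Pow (carrier_mat s m)"
      using rank_codeD(1) by blast
  qed (simp add: finite_carrier_mat)
  let ?g = "\<lambda>C. (shorten n m (n - d) d C, shorten n m 0 (n - 1) C)"
  have "card ?X \<le> card (?Y \<times> ?Z)"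
  proof (rule card_inj_on_le)
    show "inj_on ?g ?X"
    proof (rule inj_onI)
      fix C C' assume C: "C \<in> ?X" "C' \<in> ?X" and "?g C = ?g C'"
      then show "C = C'"
        using maximal_code_eq_sum_shortened[of n m d C] maximal_code_eq_sum_shortened[of n m d C'] d
        by simp
    qed
    show "?g ` ?X \<subseteq> ?Y \<times> ?Z"
    proof (intro image_subsetI SigmaI CollectI conjI)
      fix C assume "C \<in> ?X"
      then have C: "rank_code n m d C" "card C = CARD('a) ^ (m * (n - d + 1))"
        by auto
      show "rank_code d m d (shorten n m (n - d) d C)"
          "rank_code (n - 1) m d (shorten n m 0 (n - 1) C)"
        using d by (auto intro!: rank_code_shorten[OF C(1)])
      show "card (shorten n m (n - d) d C) = CARD('a) ^ m"
        using card_shorten_maximal[OF C d(1), of d "n - d"] d by simp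
      have "n - 1 - d + 1 = n - d"
        using d by simp
      moreover have "d \<le> n - 1" "0 + (n - 1) \<le> n"
        using d by auto
      ultimately show "card (shorten n m 0 (n - 1) C) = CARD('a) ^ (m * (n - d))"
        using card_shorten_maximal[OF C d(1), of "n - 1" 0] by simp
    qed
    show "finite (?Y \<times> ?Z)"
      using fin by (intro finite_cartesian_product)
  qed
  then show ?thesis
    by (simp add: card_cartesian_product)
qed

section \<open>The density inequality\<close>

theorem proposition7p3:
  fixes q m n d :: nat
  assumes "primepow q"
    and "CARD('a::{field,finite}) = q"
    and "m \<ge> n" and "n \<ge> 3"
    and "2 \<le> d" and "d < n"
  shows "code_density TYPE('a) n m (m * (n - d + 1)) d
    \<le> code_density TYPE('a) d m m d
        * code_density TYPE('a) (n - 1) m (m * (n - d)) d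
        * (B_q q n m d / A_q q n m d)"
proof -
  have density: "code_density TYPE('a) s m k d
      = real (card {C :: 'a mat set. rank_code s m d C \<and> card C = CARD('a) ^ k})
        / q_binomial q (m * s) k" if "1 \<le> k" for s k
    using that assms(2) by (simp add: code_density_def code_iff_rank_code)
  have k: "1 \<le> m * (n - d + 1)" "1 \<le> m" "1 \<le> m * (n - d)"
    using assms by auto
  have "2 \<le> q"
    using one_less_card_field[where 'a = 'a] assms(2) by simp
  then have pos: "0 < q_binomial q (m * n) (m * (n - d + 1))" "0 < q_binomial q (m * d) m"
      "0 < q_binomial q (m * (n - 1)) (m * (n - d))"
    using assms by (intro q_binomial_pos mult_le_mono2; simp)+
  have "real (card {C :: 'a mat set. rank_code n m d C \<and> card C = CARD('a) ^ (m * (n - d + 1))})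
    \<le> real (card {C :: 'a mat set. rank_code d m d C \<and> card C = CARD('a) ^ m})
      * real (card {C :: 'a mat set. rank_code (n - 1) m d C \<and> card C = CARD('a) ^ (m * (n - d))})"
    unfolding of_nat_mult[symmetric] of_nat_le_iff
    using assms by (intro card_maximal_codes_le) auto
  then show ?thesis
    unfolding density[OF k(1)] density[OF k(2)] density[OF k(3)] A_q_def B_q_def
    using pos by (simp add: divide_right_mono)
qed

end
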